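(* Let $a\in\mathbb{R}$, $n\in\mathbb{Z}_+$, $\alpha\in(0,1)$, and let $w:\mathbb{N}_a\to\mathbb{R}\setminus\{0\}$ satisfy $\frac{w(a)}{w(k)}>0$ for all $k\in\mathbb{N}_{a+1}$. Let $\phi:\mathbb{N}_a\to\mathbb{R}^n$ be monotonically decreasing (componentwise) and let $x:\mathbb{N}_a\to\mathbb{R}^n$ be non-negative (componentwise). Then for all $k\in\mathbb{N}_{a+1}$, $${}_a^{\rm C}\nabla_k^{\alpha,w(k)}[\phi^{\rm T}(k)x(k)]\le \phi^{\rm T}(k)\,{}_a^{\rm C}\nabla_k^{\alpha,w(k)}x(k),$$ $${}_a^{\rm R}\nabla_k^{\alpha,w(k)}[\phi^{\rm T}(k)x(k)]\le \phi^{\rm T}(k)\,{}_a^{\rm R}\nabla_k^{\alpha,w(k)}x(k),$$ $${}_a^{\rm G}\nabla_k^{\alpha,w(k)}[\phi^{\rm T}(k)x(k)]\le \phi^{\rm T}(k)\,{}_a^{\rm G}\nabla_k^{\alpha,w(k)}x(k).$$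
   Context: For $a\in\mathbb{R}$, $\mathbb{N}_a:=\{a,a+1,a+2,\dots\}$. The nabla difference is $\nabla x(k):=x(k)-x(k-1)$. For $\beta\in(-1,1)$, the Grünwald–Letnikov difference/sum is $${}_a^{\rm G}\nabla_k^{\beta}x(k):=\sum_{i=0}^{k-a-1}(-1)^i\binom{\beta}{i}x(k-i),\qquad \binom{p}{q}:=\frac{\Gamma(p+1)}{\Gamma(q+1)\Gamma(p-q+1)},$$ with the empty sum (at $k=a$) equal to $0$. For $\alpha\in(0,1)$ and $k\in\mathbb{N}_{a+1}$, ${}_a^{\rm R}\nabla_k^{\alpha}x(k):=\nabla\,{}_a^{\rm G}\nabla_k^{\alpha-1}x(k)$ (Riemann–Liouville) and ${}_a^{\rm C}\nabla_k^{\alpha}x(k):={}_a^{\rm G}\nabla_k^{\alpha-1}\nabla x(k)$ (Caputo). Given a tempered function $w$, for each ${\rm X}\in\{{\rm G},{\rm R},{\rm C}\}$ the tempered operator is ${}_a^{\rm X}\nabla_k^{\alpha,w(k)}x(k):=w^{-1}(k)\,{}_a^{\rm X}\nabla_k^{\alpha}[w(k)x(k)]$, where $w^{-1}(k)=1/w(k)$; on vector-valued sequences all operators act componentwise. *)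

theory Defs
  imports "HOL-Analysis.Analysis"
begin

(* Sequences on nat_from a are total functions on the reals. At arguments in nat_from (a + 1),
   the operators below only evaluate them at points of nat_from a. *)
definition nat_from :: "real \<Rightarrow> real set" where
  "nat_from a = {a + real m | m. True}"

definition nabla :: "(real \<Rightarrow> real) \<Rightarrow> real \<Rightarrow> real" where
  "nabla x k = x k - x (k - 1)"

definition Gamma_binom :: "real \<Rightarrow> real \<Rightarrow> real" where
  "Gamma_binom p q = Gamma (p + 1) / (Gamma (q + 1) * Gamma (p - q + 1))"

(* The index set is {0, ..., k - a - 1}; it is empty for k = a. *)
definition GL_diff :: "real \<Rightarrow> real \<Rightarrow> (real \<Rightarrow> real) \<Rightarrow> real \<Rightarrow> real" where
  "GL_diff a \<beta> x k =
     (\<Sum>i\<in>{i::nat. real i \<le> k - a - 1}. (-1) ^ i * Gamma_binom \<beta> (real i) * x (k - real i))"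

definition RL_diff :: "real \<Rightarrow> real \<Rightarrow> (real \<Rightarrow> real) \<Rightarrow> real \<Rightarrow> real" where
  "RL_diff a \<alpha> x k = nabla (GL_diff a (\<alpha> - 1) x) k"

definition Caputo_diff :: "real \<Rightarrow> real \<Rightarrow> (real \<Rightarrow> real) \<Rightarrow> real \<Rightarrow> real" where
  "Caputo_diff a \<alpha> x k = GL_diff a (\<alpha> - 1) (nabla x) k"

definition tempered ::
    "((real \<Rightarrow> real) \<Rightarrow> real \<Rightarrow> real) \<Rightarrow> (real \<Rightarrow> real) \<Rightarrow> (real \<Rightarrow> real) \<Rightarrow> real \<Rightarrow> real" where
  "tempered D w x k = 1 / w k * D (\<lambda>j. w j * x j) k"

definition componentwise ::
    "((real \<Rightarrow> real) \<Rightarrow> real \<Rightarrow> real) \<Rightarrow> (real \<Rightarrow> real ^ 'n) \<Rightarrow> real \<Rightarrow> real ^ 'n" where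
  "componentwise D x k = (\<chi> j. D (\<lambda>l. x l $ j) k)"

end

theory Submission
  imports Defs
begin

text \<open>
  At a fixed point \<open>k = a + m\<close>, \<open>m \<ge> 1\<close>, each of the three operators is a finite linear combination
  \<open>\<Sum>i\<le>m. d i * y (k - i)\<close> of the present and past values of \<open>y\<close>, and all weights \<open>d i\<close> of strictly
  past values (\<open>i \<ge> 1\<close>) are non-positive. That sign pattern alone gives the inequality
  (\<open>tempered_past_nonpos_le\<close>): in
  \<open>\<Sum>i\<le>m. d i * (w (k - i) / w k) * ((\<phi> (k - i) - \<phi> k) \<bullet> x (k - i))\<close>
  the term \<open>i = 0\<close> vanishes, and in every other term the weight is non-positive, the quotient of
  values of \<open>w\<close> is positive because all these values have the sign of \<open>w a\<close>, and the inner product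
  is non-negative because \<open>\<phi>\<close> decreases and \<open>x \<ge> 0\<close>.

  The sign pattern comes from the coefficients \<open>(-1) ^ i * (\<beta> gchoose i)\<close>. For \<open>\<beta> = \<alpha>\<close> they are
  non-positive from \<open>i = 1\<close> on; for \<open>\<beta> = \<alpha> - 1\<close> they are positive, and by Pascal's rule their
  successive differences are the coefficients for \<open>\<alpha>\<close>. Summation by parts then shows that the
  Riemann-Liouville difference coincides with the Gruenwald-Letnikov one, and that the Caputo
  difference has one further term, a negative multiple of \<open>y a\<close>.
\<close>

definition gl_coeff :: "real \<Rightarrow> nat \<Rightarrow> real" where
  "gl_coeff \<beta> i = (-1) ^ i * (\<beta> gchoose i)"

lemma gl_coeff_pochhammer: "gl_coeff \<beta> i = pochhammer (- \<beta>) i / fact i"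
  by (simp add: gl_coeff_def gbinomial_pochhammer flip: mult.assoc power_add)

lemma gl_coeff_pos:
  assumes "\<beta> < 0"
  shows "0 < gl_coeff \<beta> i"
  using assms by (simp add: gl_coeff_pochhammer pochhammer_pos)

text \<open>
  In \<open>pochhammer (- \<beta>) i\<close> the leading factor \<open>- \<beta>\<close> is the only one that is not positive.
\<close>

lemma gl_coeff_nonpos:
  assumes "0 \<le> \<beta>" and "\<beta> < 1" and "0 < i"
  shows "gl_coeff \<beta> i \<le> 0"
proof -
  obtain j where i: "i = Suc j"
    using \<open>0 < i\<close> gr0_conv_Suc by blast
  have "0 < pochhammer (1 - \<beta>) j"
    using \<open>\<beta> < 1\<close> by (simp add: pochhammer_pos)
  then show ?thesis
    using \<open>0 \<le> \<beta>\<close> by (simp add: gl_coeff_pochhammer i pochhammer_rec divide_le_0_iff mult_le_0_iff)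
qed

lemma gl_coeff_Suc_Pascal:
  "gl_coeff \<beta> (Suc i) = gl_coeff (\<beta> - 1) (Suc i) - gl_coeff (\<beta> - 1) i"
  using gbinomial_Suc_Suc[of "\<beta> - 1" i] by (simp add: gl_coeff_def algebra_simps)

text \<open>
  By Pascal's rule the factor collected by \<open>z (Suc i)\<close> from two neighbouring terms is a coefficient
  for \<open>\<beta>\<close>; only the last point has no right neighbour.
\<close>

lemma gl_coeff_summation_by_parts:
  "(\<Sum>i\<le>n. gl_coeff (\<beta> - 1) i * (z i - z (Suc i)))
     = (\<Sum>i\<le>n. gl_coeff \<beta> i * z i) - gl_coeff (\<beta> - 1) n * z (Suc n)"
proof (induction n)
  case 0
  show ?case
    by (simp add: gl_coeff_def algebra_simps)
next
  case (Suc n)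
  then show ?case
    by (simp add: gl_coeff_Suc_Pascal[of \<beta> n] algebra_simps)
qed

text \<open>
  For \<open>\<beta> > -1\<close> the numerator \<open>Gamma (\<beta> + 1)\<close> is not at a pole, so the quotient of Gamma values is the
  generalised binomial coefficient.
\<close>

lemma Gamma_binom_eq_gbinomial:
  assumes "-1 < \<beta>"
  shows "Gamma_binom \<beta> (real i) = \<beta> gchoose i"
proof -
  have "\<beta> + 1 \<notin> \<int>\<^sub>\<le>\<^sub>0"
    using assms by (auto elim!: nonpos_Ints_cases)
  then show ?thesis
    by (simp add: Gamma_binom_def gbinomial_Gamma Gamma_fact add.commute)
qed

lemma GL_diff_eq_sum:
  assumes "-1 < \<beta>"
  shows "GL_diff a \<beta> y (a + real m) = (\<Sum>i<m. gl_coeff \<beta> i * y (a + real m - real i))"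
proof -
  have "{i. real i \<le> a + real m - a - 1} = {..<m}"
    by auto
  then show ?thesis
    by (simp add: GL_diff_def gl_coeff_def Gamma_binom_eq_gbinomial[OF assms])
qed

text \<open>
  The three operators at \<open>a + Suc n\<close>, as combinations of the \<open>n + 2\<close> values of \<open>y\<close> on
  \<open>a, \<dots>, a + Suc n\<close>. The oldest value \<open>y a\<close>, at index \<open>Suc n\<close>, is where they differ: its weight is
  \<open>0\<close> for Gruenwald-Letnikov and Riemann-Liouville, and the boundary weight of the summation by parts
  for Caputo.
\<close>

lemma GL_diff_expansion:
  assumes "-1 < \<alpha>"
  shows "GL_diff a \<alpha> y (a + real (Suc n))
    = (\<Sum>i\<le>Suc n. (if i \<le> n then gl_coeff \<alpha> i else 0) * y (a + real (Suc n) - real i))"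
  unfolding GL_diff_eq_sum[OF assms] lessThan_Suc_atMost by simp

lemma Caputo_diff_expansion:
  assumes "0 < \<alpha>"
  shows "Caputo_diff a \<alpha> y (a + real (Suc n))
    = (\<Sum>i\<le>Suc n. (if i \<le> n then gl_coeff \<alpha> i else - gl_coeff (\<alpha> - 1) n)
        * y (a + real (Suc n) - real i))"
proof -
  define z where "z i = y (a + real (Suc n) - real i)" for i
  have "nabla y (a + real (Suc n) - real i) = z i - z (Suc i)" for i
    by (simp add: nabla_def z_def algebra_simps)
  then have "Caputo_diff a \<alpha> y (a + real (Suc n))
      = (\<Sum>i\<le>n. gl_coeff (\<alpha> - 1) i * (z i - z (Suc i)))"
    using assms by (simp only: Caputo_diff_def GL_diff_eq_sum lessThan_Suc_atMost)
  also have "\<dots> = (\<Sum>i\<le>Suc n. (if i \<le> n then gl_coeff \<alpha> i else - gl_coeff (\<alpha> - 1) n) * z i)"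
    by (simp add: gl_coeff_summation_by_parts)
  finally show ?thesis
    by (simp only: z_def)
qed

text \<open>
  The outer difference subtracts a sum that starts one step earlier and is one term shorter; adding
  the missing term completes the Caputo sum, and that term cancels the boundary term of the
  summation by parts.
\<close>

lemma RL_diff_eq_GL_diff:
  assumes "0 < \<alpha>"
  shows "RL_diff a \<alpha> y (a + real (Suc n)) = GL_diff a \<alpha> y (a + real (Suc n))"
proof -
  define z where "z i = y (a + real (Suc n) - real i)" for i
  have z_Suc: "y (a + real n - real i) = z (Suc i)" for i
    by (simp add: z_def add_diff_eq)
  have "RL_diff a \<alpha> y (a + real (Suc n))
      = GL_diff a (\<alpha> - 1) y (a + real (Suc n)) - GL_diff a (\<alpha> - 1) y (a + real n)"
    by (simp add: RL_diff_def nabla_def algebra_simps)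
  also have "\<dots> = (\<Sum>i\<le>n. gl_coeff (\<alpha> - 1) i * z i) - (\<Sum>i<n. gl_coeff (\<alpha> - 1) i * z (Suc i))"
    using assms by (simp only: GL_diff_eq_sum lessThan_Suc_atMost z_def[symmetric] z_Suc)
  also have "\<dots> = (\<Sum>i\<le>n. gl_coeff (\<alpha> - 1) i * (z i - z (Suc i)))
      + gl_coeff (\<alpha> - 1) n * z (Suc n)"
    by (simp add: right_diff_distrib sum_subtractf flip: lessThan_Suc_atMost)
  also have "\<dots> = (\<Sum>i\<le>n. gl_coeff \<alpha> i * z i)"
    by (simp add: gl_coeff_summation_by_parts)
  also have "\<dots> = GL_diff a \<alpha> y (a + real (Suc n))"
    using assms by (simp only: GL_diff_eq_sum lessThan_Suc_atMost z_def)
  finally show ?thesis .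
qed

text \<open>
  The comparison holds term by term: moving the factor \<open>\<phi>\<close> from the argument \<open>k - i\<close> to \<open>k\<close> lowers
  the inner product with the non-negative vector \<open>x (k - i)\<close>, and the non-positive weight reverses this.
\<close>

lemma tempered_past_nonpos_le:
  fixes \<phi> x :: "real \<Rightarrow> real ^ 'n"
  assumes expansion: "\<And>y. D y k = (\<Sum>i\<le>m. d i * y (k - real i))"
    and past_nonpos: "\<And>i. 0 < i \<Longrightarrow> i \<le> m \<Longrightarrow> d i \<le> 0"
    and same_sign: "\<And>i. i \<le> m \<Longrightarrow> 0 \<le> w (k - real i) / w k"
    and decreasing: "\<And>i j. i \<le> m \<Longrightarrow> \<phi> k $ j \<le> \<phi> (k - real i) $ j"
    and nonneg: "\<And>i j. i \<le> m \<Longrightarrow> 0 \<le> x (k - real i) $ j"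
  shows "tempered D w (\<lambda>l. \<phi> l \<bullet> x l) k \<le> \<phi> k \<bullet> componentwise (tempered D w) x k"
proof -
  define v where "v i = d i * (w (k - real i) / w k)" for i
  have D_sum: "tempered D w y k = (\<Sum>i\<le>m. v i * y (k - real i))" for y
    by (simp add: tempered_def expansion v_def sum_distrib_left sum_divide_distrib mult_ac)
  have "v i * (\<phi> (k - real i) \<bullet> x (k - real i)) \<le> v i * (\<phi> k \<bullet> x (k - real i))" if "i \<le> m" for i
  proof (cases "i = 0")
    case False
    have "v i \<le> 0"
      unfolding v_def using past_nonpos same_sign that False by (intro mult_nonpos_nonneg) auto
    moreover have "\<phi> k \<bullet> x (k - real i) \<le> \<phi> (k - real i) \<bullet> x (k - real i)"
      unfolding inner_vec_def inner_real_def
      using decreasing nonneg that by (intro sum_mono mult_right_mono) auto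
    ultimately show ?thesis
      by (simp add: mult_left_mono_neg)
  qed simp
  then have "tempered D w (\<lambda>l. \<phi> l \<bullet> x l) k \<le> (\<Sum>i\<le>m. v i * (\<phi> k \<bullet> x (k - real i)))"
    unfolding D_sum by (intro sum_mono) simp
  also have "\<dots> = \<phi> k \<bullet> (\<Sum>i\<le>m. v i *\<^sub>R x (k - real i))"
    by (simp add: inner_sum_right)
  also have "(\<Sum>i\<le>m. v i *\<^sub>R x (k - real i)) = componentwise (tempered D w) x k"
    by (simp add: vec_eq_iff componentwise_def D_sum)
  finally show ?thesis .
qed

theorem theorem3p9:
  fixes a \<alpha> :: real
    and w :: "real \<Rightarrow> real"
    and \<phi> x :: "real \<Rightarrow> real ^ 'n"
  assumes "0 < \<alpha>" and "\<alpha> < 1"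
    and "\<forall>k\<in>nat_from a. w k \<noteq> 0"
    and "\<forall>k\<in>nat_from (a + 1). w a / w k > 0"
    and "\<forall>j. antimono_on (nat_from a) (\<lambda>k. \<phi> k $ j)"
    and "\<forall>k\<in>nat_from a. \<forall>j. 0 \<le> x k $ j"
  shows "\<forall>k\<in>nat_from (a + 1).
      tempered (Caputo_diff a \<alpha>) w (\<lambda>l. \<phi> l \<bullet> x l) k
        \<le> \<phi> k \<bullet> componentwise (tempered (Caputo_diff a \<alpha>) w) x k
    \<and> tempered (RL_diff a \<alpha>) w (\<lambda>l. \<phi> l \<bullet> x l) k
        \<le> \<phi> k \<bullet> componentwise (tempered (RL_diff a \<alpha>) w) x k
    \<and> tempered (GL_diff a \<alpha>) w (\<lambda>l. \<phi> l \<bullet> x l) k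
        \<le> \<phi> k \<bullet> componentwise (tempered (GL_diff a \<alpha>) w) x k"
proof
  fix k
  assume "k \<in> nat_from (a + 1)"
  then obtain n where k: "k = a + real (Suc n)"
    by (auto simp: nat_from_def)
  have past: "k - real i \<in> nat_from a" if "i \<le> Suc n" for i
    unfolding nat_from_def k using that
    by (auto intro!: exI[of _ "Suc n - i"] simp: of_nat_diff)
  have k_in: "k \<in> nat_from a"
    using past[of 0] by simp
  have a_sign: "0 < w a / w l" if l_in: "l \<in> nat_from a" for l
  proof -
    obtain m where l: "l = a + real m"
      using l_in by (auto simp: nat_from_def)
    show ?thesis
    proof (cases m)
      case 0
      then show ?thesis
        using assms(3) l_in l by simp
    next
      case (Suc m')
      then have "l \<in> nat_from (a + 1)"
        by (auto simp: l nat_from_def)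
      then show ?thesis
        using assms(4) by blast
    qed
  qed
  have same_sign: "0 \<le> w (k - real i) / w k" if "i \<le> Suc n" for i
    using a_sign[OF past[OF that]] a_sign[OF k_in]
    by (auto simp: zero_less_divide_iff zero_le_divide_iff)
  have decreasing: "\<phi> k $ j \<le> \<phi> (k - real i) $ j" if "i \<le> Suc n" for i j
    using assms(5) past[OF that] k_in by (auto simp: monotone_on_def)
  have nonneg: "0 \<le> x (k - real i) $ j" if "i \<le> Suc n" for i j
    using assms(6) past[OF that] by blast
  have coeff_nonpos: "gl_coeff \<alpha> i \<le> 0" if "0 < i" for i
    using assms(1,2) that by (simp add: gl_coeff_nonpos)
  have boundary: "0 < gl_coeff (\<alpha> - 1) n"
    using assms(2) by (simp add: gl_coeff_pos)
  have GL: "GL_diff a \<alpha> y k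
      = (\<Sum>i\<le>Suc n. (if i \<le> n then gl_coeff \<alpha> i else 0) * y (k - real i))" for y
    unfolding k by (rule GL_diff_expansion) (use assms(1) in simp)
  have RL: "RL_diff a \<alpha> y k
      = (\<Sum>i\<le>Suc n. (if i \<le> n then gl_coeff \<alpha> i else 0) * y (k - real i))" for y
    using RL_diff_eq_GL_diff[OF assms(1)] GL k by simp
  have Caputo: "Caputo_diff a \<alpha> y k
      = (\<Sum>i\<le>Suc n. (if i \<le> n then gl_coeff \<alpha> i else - gl_coeff (\<alpha> - 1) n) * y (k - real i))" for y
    unfolding k by (rule Caputo_diff_expansion) (rule assms(1))
  have compare: "tempered D w (\<lambda>l. \<phi> l \<bullet> x l) k
      \<le> \<phi> k \<bullet> componentwise (tempered D w) x k"
    if "\<And>y. D y k = (\<Sum>i\<le>Suc n. d i * y (k - real i))"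
      and "\<And>i. 0 < i \<Longrightarrow> i \<le> Suc n \<Longrightarrow> d i \<le> 0" for D d
    using that same_sign decreasing nonneg
    by (rule tempered_past_nonpos_le[where m = "Suc n" and d = d])
  show "tempered (Caputo_diff a \<alpha>) w (\<lambda>l. \<phi> l \<bullet> x l) k
        \<le> \<phi> k \<bullet> componentwise (tempered (Caputo_diff a \<alpha>) w) x k
    \<and> tempered (RL_diff a \<alpha>) w (\<lambda>l. \<phi> l \<bullet> x l) k
        \<le> \<phi> k \<bullet> componentwise (tempered (RL_diff a \<alpha>) w) x k
    \<and> tempered (GL_diff a \<alpha>) w (\<lambda>l. \<phi> l \<bullet> x l) k
        \<le> \<phi> k \<bullet> componentwise (tempered (GL_diff a \<alpha>) w) x k"
    using coeff_nonpos boundary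
    by (intro conjI compare[where D = "Caputo_diff a \<alpha>", OF Caputo]
        compare[where D = "RL_diff a \<alpha>", OF RL] compare[where D = "GL_diff a \<alpha>", OF GL])
      (auto simp: less_imp_le)
qed

end
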